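(* Let $R$ be any ring, and let $\{I_s\mid s\in S\}$ (with $S\neq\emptyset$) be a downward directed collection of prime ideals of $R$; that is, for all $s,t\in S$ there exists $r\in S$ such that $I_r\subseteq I_s\cap I_t$. Then $I=\bigcap_{s\in S}I_s$ is a prime ideal of $R$. Consequently, if $(P,\leq)$ is a partially ordered set that is order-isomorphic to $(\mathrm{Spec}(R),\subseteq)$ for some ring $R$, then every downward directed subset of $P$ has a greatest lower bound in $P$.
   Context: Rings are associative, not necessarily unital or commutative. A prime ideal of $R$ is a proper two-sided ideal $I$ such that for all $x,y\in R$, $xRy\subseteq I$ implies $x\in I$ or $y\in I$. $\mathrm{Spec}(R)$ is the set of prime ideals of $R$, ordered by inclusion. A subset $S$ of a poset is downward directed if it is nonempty and for all $p,q\in S$ there is $r\in S$ with $r\leq p$ and $r\leq q$. *)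

theory Defs
  imports Complex_Main "HOL-Algebra.Order"
begin

(* The type class "ring" is that of associative rings, neither unital nor commutative in general. *)

definition two_sided_ideal :: "'a::ring set \<Rightarrow> bool" where
  "two_sided_ideal I \<longleftrightarrow>
     0 \<in> I \<and> (\<forall>a\<in>I. \<forall>b\<in>I. a + b \<in> I) \<and> (\<forall>a\<in>I. - a \<in> I) \<and>
     (\<forall>r. \<forall>a\<in>I. r * a \<in> I \<and> a * r \<in> I)"

definition prime_ideal :: "'a::ring set \<Rightarrow> bool" where
  "prime_ideal I \<longleftrightarrow>
     two_sided_ideal I \<and> I \<noteq> UNIV \<and>
     (\<forall>x y. {x * r * y | r. True} \<subseteq> I \<longrightarrow> x \<in> I \<or> y \<in> I)"

definition Spec :: "'a::ring set gorder" where
  "Spec = \<lparr>carrier = {I. prime_ideal I}, eq = (=), le = (\<subseteq>)\<rparr>"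

lemma partial_order_Spec: "partial_order Spec"
  by unfold_locales (auto simp: Spec_def)

definition order_isomorphic :: "('a, 'm) gorder_scheme \<Rightarrow> ('b, 'n) gorder_scheme \<Rightarrow> bool" where
  "order_isomorphic P Q \<longleftrightarrow>
     (\<exists>f. bij_betw f (carrier P) (carrier Q) \<and> order_emb P Q f)"

definition downward_directed :: "('a, 'm) gorder_scheme \<Rightarrow> 'a set \<Rightarrow> bool" where
  "downward_directed P D \<longleftrightarrow>
     D \<subseteq> carrier P \<and> D \<noteq> {} \<and>
     (\<forall>p\<in>D. \<forall>q\<in>D. \<exists>r\<in>D. r \<sqsubseteq>\<^bsub>P\<^esub> p \<and> r \<sqsubseteq>\<^bsub>P\<^esub> q)"

end

theory Submission
  imports Defs
begin

text \<open>An intersection of two-sided ideals is a two-sided ideal, and over a nonempty index set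
  it is proper because it lies inside a proper member. Directedness is what gives primeness: if x
  and y both escape the intersection, then x escapes some I_s and y some I_t, and a member I_r below
  both omits x and y simultaneously. Since xRy lies in the intersection, it lies in I_r, against the
  primeness of I_r. This is \<open>prime_ideal_directed_INT\<close>. For the order-theoretic
  consequence, an isomorphism f onto \<open>Spec\<close> turns a directed D into a directed family
  of primes. Its intersection is again a point of \<open>Spec\<close>, and the preimage of that
  point is the infimum of D (\<open>is_glb_if_image_Inter\<close>).\<close>

lemma two_sided_ideal_INT:
  assumes "\<And>s. s \<in> S \<Longrightarrow> two_sided_ideal (I s)"
  shows "two_sided_ideal (\<Inter>s\<in>S. I s)"
  using assms by (simp add: two_sided_ideal_def)

lemma prime_ideal_directed_INT:
  assumes "S \<noteq> {}" and prime: "\<And>s. s \<in> S \<Longrightarrow> prime_ideal (I s)"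
    and directed: "\<And>s t. s \<in> S \<Longrightarrow> t \<in> S \<Longrightarrow> \<exists>r\<in>S. I r \<subseteq> I s \<inter> I t"
  shows "prime_ideal (\<Inter>s\<in>S. I s)"
  unfolding prime_ideal_def
proof (intro conjI allI impI)
  show "two_sided_ideal (\<Inter>s\<in>S. I s)"
    using prime by (intro two_sided_ideal_INT) (simp add: prime_ideal_def)
  show "(\<Inter>s\<in>S. I s) \<noteq> UNIV"
  proof -
    obtain s where "s \<in> S"
      using assms(1) by blast
    then show ?thesis
      using prime[of s] by (auto simp: prime_ideal_def)
  qed
  fix x y
  assume xy: "{x * r * y | r. True} \<subseteq> (\<Inter>s\<in>S. I s)"
  show "x \<in> (\<Inter>s\<in>S. I s) \<or> y \<in> (\<Inter>s\<in>S. I s)"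
  proof (rule ccontr)
    assume "\<not> ?thesis"
    then obtain s t where st: "s \<in> S" "x \<notin> I s" "t \<in> S" "y \<notin> I t"
      by blast
    \<comment> \<open>One member that omits both elements at once; for two unrelated primes the
      argument would break down here.\<close>
    then obtain r where r: "r \<in> S" "I r \<subseteq> I s \<inter> I t"
      using directed by blast
    have "{x * r * y | r. True} \<subseteq> I r"
      using subset_trans[OF xy INF_lower[OF r(1)]] .
    then have "x \<in> I r \<or> y \<in> I r"
      using prime[OF r(1)] unfolding prime_ideal_def by simp
    with st r(2) show False
      by blast
  qed
qed

lemma order_emb_Spec_le_iff:
  assumes "order_emb P Spec f" "a \<in> carrier P" "b \<in> carrier P"
  shows "a \<sqsubseteq>\<^bsub>P\<^esub> b \<longleftrightarrow> f a \<subseteq> f b"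
  using assms by (simp add: order_emb_def Spec_def)

text \<open>Intersection is the infimum for inclusion among all subsets of the ring, and an order
  embedding reflects comparisons. So once the intersection is attained as a value of f, the point
  attaining it is the infimum in P.\<close>

lemma is_glb_if_image_Inter:
  assumes emb: "order_emb P (Spec :: 'b::ring set gorder) f"
    and D: "D \<subseteq> carrier P" and g: "g \<in> carrier P" "f g = (\<Inter>d\<in>D. f d)"
  shows "is_glb P g D"
proof -
  note le_iff = order_emb_Spec_le_iff[OF emb]
  show ?thesis
  proof (rule greatest_LowerI[OF _ _ D g(1)])
    fix x
    assume "x \<in> D"
    then show "g \<sqsubseteq>\<^bsub>P\<^esub> x"
      using le_iff[OF g(1)] D g(2) by blast
  next
    fix l
    assume "l \<in> Lower P D"
    then have lP: "l \<in> carrier P" and l: "\<And>x. x \<in> D \<Longrightarrow> l \<sqsubseteq>\<^bsub>P\<^esub> x"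
      using D by (auto simp: Lower_def)
    have "f l \<subseteq> f x" if "x \<in> D" for x
      using l[OF that] le_iff[OF lP] D that by blast
    then show "l \<sqsubseteq>\<^bsub>P\<^esub> g"
      using le_iff[OF lP g(1)] g(2) by blast
  qed
qed

lemma downward_directed_has_glb:
  assumes iso: "order_isomorphic P (Spec :: 'b::ring set gorder)"
    and D: "downward_directed P D"
  shows "\<exists>g. is_glb P g D"
proof -
  obtain f where bij: "bij_betw f (carrier P) (carrier (Spec :: 'b set gorder))"
    and emb: "order_emb P (Spec :: 'b set gorder) f"
    using iso unfolding order_isomorphic_def by blast
  have sub: "D \<subseteq> carrier P" and ne: "D \<noteq> {}"
    using D by (auto simp: downward_directed_def)
  have le: "f a \<subseteq> f b" if "a \<in> D" "b \<in> D" "a \<sqsubseteq>\<^bsub>P\<^esub> b" for a b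
    using order_emb_Spec_le_iff[OF emb, of a b] that sub by blast
  have "prime_ideal (\<Inter>d\<in>D. f d)"
  \<comment> \<open>The family is f indexed by D itself; monotonicity of f carries the directedness
    of D over to the prime ideals.\<close>
  proof (rule prime_ideal_directed_INT[OF ne])
    show "prime_ideal (f d)" if "d \<in> D" for d
      using bij_betwE[OF bij] that sub by (auto simp: Spec_def)
    show "\<exists>r\<in>D. f r \<subseteq> f s \<inter> f t" if st: "s \<in> D" "t \<in> D" for s t
    proof -
      obtain r where "r \<in> D" "r \<sqsubseteq>\<^bsub>P\<^esub> s" "r \<sqsubseteq>\<^bsub>P\<^esub> t"
        using D st unfolding downward_directed_def by blast
      with le st show ?thesis
        by (metis le_inf_iff)
    qed
  qed
  \<comment> \<open>Surjectivity of f onto the prime ideals enters here: the intersection, now known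
    to be prime, has a preimage in P.\<close>
  then have "(\<Inter>d\<in>D. f d) \<in> f ` carrier P"
    using bij by (simp add: bij_betw_def Spec_def)
  then obtain g where "g \<in> carrier P" "f g = (\<Inter>d\<in>D. f d)"
    by force
  with is_glb_if_image_Inter[OF emb sub] show ?thesis
    by blast
qed

theorem proposition3:
  shows "(\<forall>(S :: 's set) (I :: 's \<Rightarrow> 'a::ring set).
            S \<noteq> {} \<and> (\<forall>s\<in>S. prime_ideal (I s)) \<and>
            (\<forall>s\<in>S. \<forall>t\<in>S. \<exists>r\<in>S. I r \<subseteq> I s \<inter> I t) \<longrightarrow>
            prime_ideal (\<Inter>s\<in>S. I s)) \<and>
         (\<forall>P :: ('p, 'm) gorder_scheme.
            partial_order P \<and> order_isomorphic P (Spec :: 'b::ring set gorder) \<longrightarrow>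
            (\<forall>D. downward_directed P D \<longrightarrow> (\<exists>g. is_glb P g D)))"
proof (intro conjI allI impI)
  fix S :: "'s set" and I :: "'s \<Rightarrow> 'a set"
  assume "S \<noteq> {} \<and> (\<forall>s\<in>S. prime_ideal (I s)) \<and>
    (\<forall>s\<in>S. \<forall>t\<in>S. \<exists>r\<in>S. I r \<subseteq> I s \<inter> I t)"
  then show "prime_ideal (\<Inter>s\<in>S. I s)"
    by (intro prime_ideal_directed_INT) auto
next
  fix P :: "('p, 'm) gorder_scheme" and D
  assume "partial_order P \<and> order_isomorphic P (Spec :: 'b set gorder)"
    and "downward_directed P D"
  then show "\<exists>g. is_glb P g D"
    using downward_directed_has_glb by blast
qed

end
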